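(* There exist Gauss words that are not homotopically trivial, i.e. Gauss words that are not homotopic to the empty Gauss word $\emptyset$.
   Context: An alphabet is a finite set, whose elements are called letters. A word on an alphabet $\mathcal{A}$ is a finite (possibly empty) sequence of letters of $\mathcal{A}$; $\emptyset$ denotes the empty word. A Gauss word on $\mathcal{A}$ is a word in which every letter of $\mathcal{A}$ appears exactly twice (so $\mathcal{A}$ is the set of letters appearing in the word). Gauss words $u$ on $\mathcal{A}$ and $v$ on $\mathcal{B}$ are isomorphic if there is a bijection $f:\mathcal{A}\to\mathcal{B}$ such that $f$ applied letterwise to $u$ gives $v$. The homotopy moves on Gauss words are the following (each may be applied in either direction), where $A,B,C$ are individual (distinct) letters and $t,x,y,z$ are arbitrary, possibly empty, sequences of letters such that both sides are Gauss words: Shift: $AxAy \leftrightarrow xAyA$; H1: $xAAy \leftrightarrow xy$; H2: $xAByBAz \leftrightarrow xyz$; H3: $xAByACzBCt \leftrightarrow xBAyCAzCBt$. Two Gauss words are homotopic if one can be transformed into the other by a finite sequence of isomorphisms and homotopy moves. *)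

theory Defs
  imports Main "HOL-Library.Infinite_Typeclass"
begin

text \<open>
  Letters are the elements of a type; the alphabet of a Gauss word \<open>w\<close> is the finite set \<open>set w\<close>,
  so ``every letter of the alphabet appears exactly twice'' is a condition on \<open>w\<close> alone.
\<close>

definition gauss_word :: "'a list \<Rightarrow> bool" where
  "gauss_word w \<longleftrightarrow> (\<forall>a\<in>set w. count_list w a = 2)"

definition gauss_isomorphic :: "'a list \<Rightarrow> 'b list \<Rightarrow> bool" where
  "gauss_isomorphic u v \<longleftrightarrow> (\<exists>f. bij_betw f (set u) (set v) \<and> map f u = v)"

text \<open>The moves read from left to right; that both sides are Gauss words is required in
  \<open>homotopy_step\<close>, where both directions are also allowed.\<close>

inductive homotopy_move :: "'a list \<Rightarrow> 'a list \<Rightarrow> bool" where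
  Shift: "homotopy_move ([A] @ x @ [A] @ y) (x @ [A] @ y @ [A])"
| H1: "homotopy_move (x @ [A, A] @ y) (x @ y)"
| H2: "distinct [A, B] \<Longrightarrow> homotopy_move (x @ [A, B] @ y @ [B, A] @ z) (x @ y @ z)"
| H3: "distinct [A, B, C] \<Longrightarrow>
    homotopy_move (x @ [A, B] @ y @ [A, C] @ z @ [B, C] @ t)
                  (x @ [B, A] @ y @ [C, A] @ z @ [C, B] @ t)"

definition homotopy_step :: "'a list \<Rightarrow> 'a list \<Rightarrow> bool" where
  "homotopy_step u v \<longleftrightarrow> gauss_word u \<and> gauss_word v \<and>
     (gauss_isomorphic u v \<or> homotopy_move u v \<or> homotopy_move v u)"

text \<open>
  The letter type has to be infinite: the inverses of the moves \<open>H1\<close> and \<open>H2\<close> need fresh letters,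
  which a finite type could not always supply.  Over an infinite type every
  finite chain of words over arbitrary finite alphabets can be relabelled into the type.
\<close>

definition homotopic :: "'a::infinite list \<Rightarrow> 'a list \<Rightarrow> bool" where
  "homotopic = homotopy_step\<^sup>*\<^sup>*"

definition homotopically_trivial :: "'a::infinite list \<Rightarrow> bool" where
  "homotopically_trivial w \<longleftrightarrow> homotopic w []"

end

theory Submission
  imports Defs
begin

text \<open>
  Call two letters of a Gauss word interlaced if their occurrences alternate. This makes the
  letters the vertices of a graph, which the shift move does not change. The other moves act on it
  as follows: \<open>H1\<close> adds or removes an isolated vertex, \<open>H2\<close> adds or removes two nonadjacent vertices
  with the same neighbours, and \<open>H3\<close> replaces the path \<open>A - B - C\<close> by the single edge \<open>A - C\<close>, where
  each remaining vertex is adjacent to none or to exactly two of \<open>A\<close>, \<open>B\<close>, \<open>C\<close>.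

  The parity of the degree of a vertex survives all three operations, and so does the parity
  of the number of common neighbours of two nonadjacent vertices, as long as at most one of them
  takes part in the \<open>H3\<close> move. Attach to each vertex \<open>A\<close> of even degree the parities of the number
  of odd-degree neighbours of \<open>A\<close> and of the number of odd-degree non-neighbours of \<open>A\<close> that have an
  odd number of common neighbours with \<open>A\<close>. For the even ones among the three vertices of an \<open>H3\<close> move these two
  parities are preserved as well: seen from an even end of the path, the other two vertices only
  exchange their roles, and seen from an even middle \<open>B\<close> the contributions of \<open>A\<close> and \<open>C\<close> cancel
  before and after (\<open>graph_invariant_triangle\<close>). An isolated vertex gets the pair (even, even) and the
  two vertices of an \<open>H2\<close> move get equal pairs. Hence the parity of the number of even vertices
  whose pair is (odd, odd) is a homotopy invariant of Gauss words. It vanishes on the empty word,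
  and it is odd on the word \<open>0 1 2 3 4 5 1 3 5 0 4 2\<close>, where only the letter \<open>0\<close> has this pair.

  The invariant has to combine the two parities: in a finite simple graph, either
  of the two counts alone is odd for an even number of vertices of even degree.
\<close>

section \<open>Parities of finite sets\<close>

definition odd_card :: "'a set \<Rightarrow> ('a \<Rightarrow> bool) \<Rightarrow> bool" where
  "odd_card V P \<longleftrightarrow> odd (card {x\<in>V. P x})"

lemma odd_card_empty [simp]: "\<not> odd_card {} P"
  by (simp add: odd_card_def)

lemma odd_card_insert [simp]:
  assumes "finite V" "a \<notin> V"
  shows "odd_card (insert a V) P \<longleftrightarrow> (P a \<noteq> odd_card V P)"
proof -
  have "{x\<in>insert a V. P x} = (if P a then insert a {x\<in>V. P x} else {x\<in>V. P x})"
    by auto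
  then show ?thesis
    using assms by (simp add: odd_card_def)
qed

lemma odd_card_cong:
  assumes "\<And>x. x \<in> V \<Longrightarrow> P x = Q x"
  shows "odd_card V P = odd_card V Q"
proof -
  have "{x\<in>V. P x} = {x\<in>V. Q x}"
    using assms by blast
  then show ?thesis
    by (simp add: odd_card_def)
qed

lemma odd_card_xor:
  assumes "finite V"
  shows "odd_card V (\<lambda>x. P x \<noteq> Q x) \<longleftrightarrow> (odd_card V P \<noteq> odd_card V Q)"
  using assms by (induction V) auto

lemma odd_card_image:
  assumes "inj_on f V"
  shows "odd_card (f ` V) P = odd_card V (\<lambda>x. P (f x))"
proof -
  have "{y\<in>f ` V. P y} = f ` {x\<in>V. P (f x)}"
    by auto
  moreover have "inj_on f {x\<in>V. P (f x)}"
    using assms by (rule inj_on_subset) auto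
  ultimately show ?thesis
    by (simp add: odd_card_def card_image)
qed


section \<open>The invariant of a graph\<close>

definition odd_degree :: "'a set \<Rightarrow> ('a \<Rightarrow> 'a \<Rightarrow> bool) \<Rightarrow> 'a \<Rightarrow> bool" where
  "odd_degree V L a \<longleftrightarrow> odd_card V (L a)"

definition odd_common :: "'a set \<Rightarrow> ('a \<Rightarrow> 'a \<Rightarrow> bool) \<Rightarrow> 'a \<Rightarrow> 'a \<Rightarrow> bool" where
  "odd_common V L a b \<longleftrightarrow> odd_card V (\<lambda>x. L a x \<and> L b x)"

text \<open>
  The second clause rejects isolated vertices, and the first makes the other two invariant under
  \<open>H3\<close>: for a vertex of odd degree the exchange of its neighbour and non-neighbour in such a move
  may change the counts.
\<close>

definition special :: "'a set \<Rightarrow> ('a \<Rightarrow> 'a \<Rightarrow> bool) \<Rightarrow> 'a \<Rightarrow> bool" where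
  "special V L a \<longleftrightarrow> \<not> odd_degree V L a
     \<and> odd_card V (\<lambda>b. L a b \<and> odd_degree V L b)
     \<and> odd_card V (\<lambda>b. \<not> L a b \<and> odd_degree V L b \<and> odd_common V L a b)"

definition graph_invariant :: "'a set \<Rightarrow> ('a \<Rightarrow> 'a \<Rightarrow> bool) \<Rightarrow> bool" where
  "graph_invariant V L \<longleftrightarrow> odd_card V (special V L)"

lemma graph_invariant_image:
  assumes inj: "inj_on f V"
    and L: "\<And>x y. x \<in> V \<Longrightarrow> y \<in> V \<Longrightarrow> L' (f x) (f y) = L x y"
  shows "graph_invariant (f ` V) L' = graph_invariant V L"
proof -
  have deg: "odd_degree (f ` V) L' (f x) = odd_degree V L x" if "x \<in> V" for x
    unfolding odd_degree_def odd_card_image[OF inj]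
    using that by (intro odd_card_cong) (simp add: L)
  have com: "odd_common (f ` V) L' (f x) (f y) = odd_common V L x y"
    if "x \<in> V" "y \<in> V" for x y
    unfolding odd_common_def odd_card_image[OF inj]
    using that by (intro odd_card_cong) (simp add: L)
  have "special (f ` V) L' (f x) = special V L x" if "x \<in> V" for x
  proof -
    have "odd_card V (\<lambda>b. L' (f x) (f b) \<and> odd_degree (f ` V) L' (f b))
        = odd_card V (\<lambda>b. L x b \<and> odd_degree V L b)"
      using that by (intro odd_card_cong) (simp add: L deg)
    moreover have "odd_card V (\<lambda>b. \<not> L' (f x) (f b) \<and> odd_degree (f ` V) L' (f b)
          \<and> odd_common (f ` V) L' (f x) (f b))
        = odd_card V (\<lambda>b. \<not> L x b \<and> odd_degree V L b \<and> odd_common V L x b)"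
      using that by (intro odd_card_cong) (simp add: L deg com)
    ultimately show ?thesis
      using that by (simp add: special_def odd_card_image[OF inj] deg)
  qed
  then show ?thesis
    unfolding graph_invariant_def odd_card_image[OF inj] by (intro odd_card_cong) simp
qed

lemma graph_invariant_cong:
  assumes "\<And>x y. x \<in> V \<Longrightarrow> y \<in> V \<Longrightarrow> L' x y = L x y"
  shows "graph_invariant V L' = graph_invariant V L"
  using graph_invariant_image[of id V L' L] assms by simp

text \<open>
  An isolated vertex contributes to no count of neighbours. It may well be a non-neighbour of
  another vertex, but its degree is even, so it is not counted there either; and it is not special
  itself, since it lacks neighbours of odd degree.
\<close>

lemma graph_invariant_isolated:
  assumes fin: "finite V" "a \<notin> V"
    and iso: "\<And>x. \<not> L a x" "\<And>x. \<not> L x a"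
  shows "graph_invariant (insert a V) L = graph_invariant V L"
proof -
  have deg: "odd_degree (insert a V) L = odd_degree V L"
    using fin iso by (simp add: odd_degree_def fun_eq_iff)
  have com: "odd_common (insert a V) L = odd_common V L"
    using fin iso by (simp add: odd_common_def fun_eq_iff)
  have "\<not> odd_degree V L a"
    using iso by (simp add: odd_degree_def odd_card_def)
  then have "special (insert a V) L = special V L"
    using fin iso by (simp add: special_def deg com fun_eq_iff)
  moreover have "\<not> special V L a"
    using iso by (simp add: special_def odd_card_def)
  ultimately show ?thesis
    using fin by (simp add: graph_invariant_def)
qed

text \<open>
  In every count the twins are taken both or not at all, so all parities agree with those of the
  smaller graph; for the same reason the twins are special both or not at all.
\<close>

lemma graph_invariant_twins:
  assumes fin: "finite V" "a \<notin> V" "b \<notin> V" "a \<noteq> b"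
    and twins: "\<And>x. L a x = L b x" "\<And>x. L x a = L x b"
  shows "graph_invariant (insert a (insert b V)) L = graph_invariant V L"
proof -
  have row: "L a = L b"
    using twins by blast
  have deg: "odd_degree (insert a (insert b V)) L = odd_degree V L"
    using fin twins(2) by (auto simp: odd_degree_def fun_eq_iff)
  have com: "odd_common (insert a (insert b V)) L = odd_common V L"
    using fin twins(2) by (auto simp: odd_common_def fun_eq_iff)
  have sym_row: "odd_degree V L a = odd_degree V L b"
    "odd_common V L x a = odd_common V L x b" for x
    by (simp_all add: odd_degree_def odd_common_def row)
  have "special (insert a (insert b V)) L = special V L"
    using fin by (auto simp: special_def deg com fun_eq_iff twins(2) sym_row)
  moreover have "special V L a = special V L b"
    by (simp add: special_def odd_degree_def odd_common_def row)
  ultimately show ?thesis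
    using fin by (auto simp: graph_invariant_def)
qed

text \<open>
  The effect of \<open>H3\<close>. Between vertices of \<open>W\<close> nothing changes. For \<open>x\<close> in \<open>W\<close> not adjacent to \<open>a\<close>,
  the number of common neighbours of \<open>x\<close> and \<open>a\<close> trades the contribution of \<open>b\<close> for that of \<open>c\<close>,
  and these agree by the parity hypothesis \<open>even\<close>; likewise for \<open>c\<close> in place of \<open>a\<close>, and for \<open>b\<close>
  the contributions of \<open>a\<close> and \<open>c\<close>, which agree, are dropped together. So only the pairs
  inside \<open>{a, b, c}\<close> need care. The degrees of \<open>a\<close>, \<open>b\<close>, \<open>c\<close> have an even sum. If
  \<open>a\<close> is even, then \<open>b\<close> and \<open>c\<close> have the same parity; seen from \<open>a\<close>, the neighbour \<open>b\<close> and the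
  non-neighbour \<open>c\<close> exchange their roles, and the parity of common neighbours of the nonadjacent
  pair comes out the same. The case of \<open>c\<close> is symmetric. If \<open>b\<close> is even, its two neighbours
  \<open>a\<close>, \<open>c\<close> become two non-neighbours, and in both positions they cancel.
\<close>

lemma graph_invariant_triangle:
  assumes fin: "finite W" and new: "a \<notin> W" "b \<notin> W" "c \<notin> W" "a \<noteq> b" "a \<noteq> c" "b \<noteq> c"
    and sym: "\<And>x y. L x y = L y x" "\<And>x y. L' x y = L' y x"
    and irrefl: "\<And>x. \<not> L x x" "\<And>x. \<not> L' x x"
    and before: "L a b" "L b c" "\<not> L a c"
    and after: "\<not> L' a b" "\<not> L' b c" "L' a c"
    and same: "\<And>x y. x \<in> W \<Longrightarrow> y \<in> insert a (insert b (insert c W)) \<Longrightarrow> L' x y = L x y"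
    and even: "\<And>x. x \<in> W \<Longrightarrow> L x b = (L x a \<noteq> L x c)"
  shows "graph_invariant (insert a (insert b (insert c W))) L'
       = graph_invariant (insert a (insert b (insert c W))) L"
proof -
  let ?V = "insert a (insert b (insert c W))"
  have split: "odd_card ?V P = (P a \<noteq> (P b \<noteq> (P c \<noteq> odd_card W P)))" for P
    using fin new by simp
  have sym': "L a x = L x a" "L b x = L x b" "L c x = L x c" for x
    using sym(1) by blast+
  have abc: "L a b" "L b a" "L b c" "L c b" "\<not> L a c" "\<not> L c a"
    "\<not> L' a b" "\<not> L' b a" "\<not> L' b c" "\<not> L' c b" "L' a c" "L' c a"
    using before after sym by blast+
  have sameW: "L' x y = L x y" "L' y x = L y x" if "x \<in> W" "y \<in> ?V" for x y
    using same[OF that] sym(1)[of x y] sym(2)[of x y] by simp_all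
  have rowW: "odd_card W (\<lambda>x. L' p x) = odd_card W (\<lambda>x. L p x)" if "p \<in> ?V" for p
    using that sameW by (auto intro!: odd_card_cong)

  \<comment> \<open>Degrees and numbers of common neighbours within \<open>W\<close>, modulo two: these are not affected by the
    move, and all parities that involve \<open>a\<close>, \<open>b\<close>, \<open>c\<close> differ from them by explicit constants.\<close>
  define m where "m p q = odd_card W (\<lambda>x. L p x \<and> L q x)" for p q
  define d where "d p = odd_card W (L p)" for p
  have m_sym: "m p q = m q p" for p q
    unfolding m_def by (simp add: conj_commute)
  have d_b: "d b = (d a \<noteq> d c)"
    unfolding d_def odd_card_xor[OF fin, symmetric]
    by (rule odd_card_cong) (simp add: sym' even)
  \<comment> \<open>A neighbour in \<open>W\<close> of one of the three vertices is adjacent to exactly one of the other two.\<close>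
  have m_sum: "d p = (m p q \<noteq> m p r)"
    if "\<And>x. x \<in> W \<Longrightarrow> L x p = (L x q \<noteq> L x r)" for p q r
    unfolding d_def m_def odd_card_xor[OF fin, symmetric]
  proof (rule odd_card_cong)
    fix x assume "x \<in> W"
    then show "L p x = ((L p x \<and> L q x) \<noteq> (L p x \<and> L r x))"
      using that sym(1) by metis
  qed
  have m_eqs: "d a = (m a b \<noteq> m a c)" "d b = (m a b \<noteq> m b c)" "d c = (m b c \<noteq> m a c)"
    using m_sum[of a b c] m_sum[of b a c] m_sum[of c b a] even by (auto simp: m_sym)

  have deg_eq: "odd_degree ?V L' x = odd_degree ?V L x" if "x \<in> ?V" for x
  proof (cases "x \<in> W")
    case True
    then show ?thesis
      unfolding odd_degree_def split using rowW[OF that] by (simp add: same)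
  next
    case False
    then have "x \<in> {a, b, c}"
      using that by blast
    then show ?thesis
      unfolding odd_degree_def split rowW[OF that]
      by (elim insertE emptyE) (simp_all add: abc irrefl)
  qed
  have deg: "odd_degree ?V L a = (\<not> d a)" "odd_degree ?V L b = d b" "odd_degree ?V L c = (\<not> d c)"
    unfolding odd_degree_def split d_def using abc irrefl by auto
  have com_W: "odd_common ?V L' x y = odd_common ?V L x y" if "x \<in> W" "y \<in> W" for x y
  proof -
    have "odd_card W (\<lambda>z. L' x z \<and> L' y z) = odd_card W (\<lambda>z. L x z \<and> L y z)"
      using that sameW by (intro odd_card_cong) simp
    then show ?thesis
      unfolding odd_common_def split using that same by simp
  qed
  have com_abc: "odd_common ?V L' x y = odd_common ?V L x y"
    "odd_common ?V L' y x = odd_common ?V L y x"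
    if "x \<in> W" "y \<in> {a,b,c}" "\<not> L x y" for x y
  proof -
    have "odd_card W (\<lambda>z. L' x z \<and> L' y z) = odd_card W (\<lambda>z. L x z \<and> L y z)"
      using that sameW by (intro odd_card_cong) auto
    then show "odd_common ?V L' x y = odd_common ?V L x y"
      unfolding odd_common_def split
      using that(2,3) same[OF that(1), of a] same[OF that(1), of b] same[OF that(1), of c]
        even[OF that(1)]
      by (elim insertE emptyE) (auto simp: abc irrefl)
    then show "odd_common ?V L' y x = odd_common ?V L y x"
      unfolding odd_common_def by (simp add: conj_commute)
  qed
  have m': "odd_card W (\<lambda>x. L' p x \<and> L' q x) = m p q" if "p \<in> {a,b,c}" "q \<in> {a,b,c}" for p q
    unfolding m_def using that sameW by (intro odd_card_cong) auto
  have com: "odd_common ?V L a c = (\<not> m a c)" "odd_common ?V L c a = (\<not> m a c)"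
    "odd_common ?V L' a b = m a b" "odd_common ?V L' b a = m a b"
    "odd_common ?V L' b c = m b c" "odd_common ?V L' c b = m b c"
    unfolding odd_common_def split using abc irrefl m'
    by (auto simp: m_sym) (auto simp: m_def conj_commute)

  have nbr_W: "odd_card W (\<lambda>y. L' x y \<and> odd_degree ?V L' y)
      = odd_card W (\<lambda>y. L x y \<and> odd_degree ?V L y)" if "x \<in> ?V" for x
    using that sameW deg_eq by (intro odd_card_cong) auto
  have non_W: "odd_card W (\<lambda>y. \<not> L' x y \<and> odd_degree ?V L' y \<and> odd_common ?V L' x y)
      = odd_card W (\<lambda>y. \<not> L x y \<and> odd_degree ?V L y \<and> odd_common ?V L x y)" if "x \<in> ?V" for x
  proof (rule odd_card_cong)
    fix y assume y: "y \<in> W"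
    have "L' x y = L x y"
      using that y sameW by auto
    moreover have "odd_degree ?V L' y = odd_degree ?V L y"
      using y deg_eq by simp
    moreover have "odd_common ?V L' x y = odd_common ?V L x y" if "\<not> L x y"
      using \<open>x \<in> ?V\<close> y that com_W com_abc(2)[of y x] sym(1)[of x y] by auto
    ultimately show "(\<not> L' x y \<and> odd_degree ?V L' y \<and> odd_common ?V L' x y)
        = (\<not> L x y \<and> odd_degree ?V L y \<and> odd_common ?V L x y)"
      by blast
  qed
  have "special ?V L' x = special ?V L x" if xV: "x \<in> ?V" for x
  proof -
    consider "x \<in> W" | "x = a" | "x = b" | "x = c"
      using xV by blast
    then show ?thesis
    proof cases
      case 1
      have "(\<not> L' x y \<and> odd_degree ?V L' y \<and> odd_common ?V L' x y)
          = (\<not> L x y \<and> odd_degree ?V L y \<and> odd_common ?V L x y)"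
        "(L' x y \<and> odd_degree ?V L' y) = (L x y \<and> odd_degree ?V L y)"
        if "y \<in> {a,b,c}" for y
        using that 1 same deg_eq com_abc by auto
      then show ?thesis
        unfolding special_def split using 1 nbr_W[OF xV] non_W[OF xV] deg_eq[OF xV] by simp
    next
      case 2
      then show ?thesis
        unfolding special_def split nbr_W[OF xV] non_W[OF xV] deg_eq[OF xV]
        using d_b m_eqs by (auto simp: deg_eq deg com abc irrefl)
    next
      case 3
      then show ?thesis
        unfolding special_def split nbr_W[OF xV] non_W[OF xV] deg_eq[OF xV]
        using d_b m_eqs by (auto simp: deg_eq deg com abc irrefl)
    next
      case 4
      then show ?thesis
        unfolding special_def split nbr_W[OF xV] non_W[OF xV] deg_eq[OF xV]
        using d_b m_eqs by (auto simp: deg_eq deg com abc irrefl)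
    qed
  qed
  then show ?thesis
    unfolding graph_invariant_def by (rule odd_card_cong)
qed


section \<open>Interlacement in Gauss words\<close>

definition interlaced :: "'a list \<Rightarrow> 'a \<Rightarrow> 'a \<Rightarrow> bool" where
  "interlaced w a b \<longleftrightarrow>
     filter (\<lambda>x. x \<in> {a, b}) w = [a, b, a, b] \<or> filter (\<lambda>x. x \<in> {a, b}) w = [b, a, b, a]"

definition word_invariant :: "'a list \<Rightarrow> bool" where
  "word_invariant w \<longleftrightarrow> graph_invariant (set w) (interlaced w)"

lemma interlaced_sym: "interlaced w a b = interlaced w b a"
  by (auto simp: interlaced_def insert_commute)

lemma gauss_word_count: "gauss_word w \<Longrightarrow> count_list w d = 0 \<or> count_list w d = 2"
  by (auto simp: gauss_word_def count_list_0_iff)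

lemma interlaced_irrefl:
  assumes "gauss_word w"
  shows "\<not> interlaced w a a"
proof
  assume "interlaced w a a"
  then have "count_list w a = 4"
  proof -
    assume il: "interlaced w a a"
    have "count_list w a = length (filter (\<lambda>x. x \<in> {a, a}) w)"
      by (induction w) auto
    then show ?thesis
      using il by (auto simp: interlaced_def)
  qed
  then show False
    using gauss_word_count[OF assms, of a] by simp
qed

text \<open>
  This asymmetric description is the convenient one for the moves, which give the
  two occurrences of a letter explicitly, while symmetry is evident from the definition.
\<close>

lemma interlaced_iff:
  assumes w: "gauss_word w" "w = x @ [a] @ y @ [a] @ z" and "d \<noteq> a"
  shows "interlaced w a d \<longleftrightarrow> count_list y d = 1"
proof -
  have "count_list x a = 0" "count_list y a = 0" "count_list z a = 0"
    using gauss_word_count[OF w(1), of a] by (simp_all add: w(2))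
  then have notin: "a \<notin> set x" "a \<notin> set y" "a \<notin> set z"
    by (simp_all add: count_list_0_iff)
  have rep: "filter (\<lambda>x. x \<in> {a, d}) u = replicate (count_list u d) d" if "a \<notin> set u" for u
    using that by (induction u) auto
  have total: "count_list x d + count_list y d + count_list z d \<in> {0, 2}"
    using gauss_word_count[OF w(1), of d] \<open>d \<noteq> a\<close> by (simp add: w(2) add.assoc)
  then have "count_list x d \<in> {0, 1, 2}" "count_list y d \<in> {0, 1, 2}" "count_list z d \<in> {0, 1, 2}"
    by auto
  moreover have "filter (\<lambda>x. x \<in> {a, d}) w = replicate (count_list x d) d @ [a]
      @ replicate (count_list y d) d @ [a] @ replicate (count_list z d) d"
    using rep notin by (simp add: w(2))
  ultimately show ?thesis
    using \<open>d \<noteq> a\<close> total unfolding interlaced_def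
    by (elim insertE emptyE) (simp_all add: numeral_2_eq_2)
qed

lemma word_invariant_cong:
  assumes "set u = set v" "\<And>a b. a \<in> set v \<Longrightarrow> b \<in> set v \<Longrightarrow> interlaced u a b = interlaced v a b"
  shows "word_invariant u = word_invariant v"
  unfolding word_invariant_def assms(1) using assms(2) by (rule graph_invariant_cong)

lemma word_invariant_isomorphic:
  assumes "gauss_isomorphic u v"
  shows "word_invariant u = word_invariant v"
proof -
  obtain f where f: "bij_betw f (set u) (set v)" "map f u = v"
    using assms unfolding gauss_isomorphic_def by blast
  have inj: "inj_on f (set u)"
    using f(1) by (rule bij_betw_imp_inj_on)
  have "interlaced v (f a) (f b) = interlaced u a b" if "a \<in> set u" "b \<in> set u" for a b
  proof -
    have flt: "filter (\<lambda>x. x \<in> {f a, f b}) v = map f (filter (\<lambda>x. x \<in> {a, b}) u)"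
      unfolding f(2)[symmetric] filter_map o_def
      using inj that by (intro arg_cong[where f = "map f"] filter_cong) (auto dest: inj_onD)
    have inj': "inj_on f (set (filter (\<lambda>x. x \<in> {a, b}) u) \<union> {a, b})"
      using inj by (rule inj_on_subset) (use that in auto)
    have "map f (filter (\<lambda>x. x \<in> {a, b}) u) = map f l \<longleftrightarrow> filter (\<lambda>x. x \<in> {a, b}) u = l"
      if "set l \<subseteq> {a, b}" for l
      using inj' that by (intro inj_on_map_eq_map inj_on_subset[OF inj']) auto
    from this[of "[a, b, a, b]"] this[of "[b, a, b, a]"] show ?thesis
      unfolding interlaced_def flt by simp
  qed
  then show ?thesis
    using graph_invariant_image[OF inj, of "interlaced v" "interlaced u"] f
    by (simp add: word_invariant_def bij_betw_imp_surj_on)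
qed

text \<open>
  The moved letter \<open>a\<close> is interlaced with \<open>d\<close> when \<open>d\<close> occurs once between its two occurrences, and
  so once outside; the shift exchanges the inside and the outside.
\<close>

lemma word_invariant_shift:
  assumes g: "gauss_word ([a] @ x @ [a] @ y)" "gauss_word (x @ [a] @ y @ [a])"
  shows "word_invariant ([a] @ x @ [a] @ y) = word_invariant (x @ [a] @ y @ [a])"
    (is "word_invariant ?u = word_invariant ?v")
proof (rule word_invariant_cong)
  fix c d
  have a: "interlaced ?u a d = interlaced ?v a d" for d
  proof (cases "d = a")
    case False
    have "interlaced ?u a d \<longleftrightarrow> count_list x d = 1"
      using interlaced_iff[OF g(1), of "[]" a x y d] False by simp
    moreover have "interlaced ?v a d \<longleftrightarrow> count_list y d = 1"
      using interlaced_iff[OF g(2), of x a y "[]" d] False by simp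
    moreover have "count_list x d + count_list y d \<in> {0, 2}"
      using gauss_word_count[OF g(1), of d] False by auto
    ultimately show ?thesis
      by auto
  qed (simp add: interlaced_irrefl g del: append.simps)
  show "interlaced ?u c d = interlaced ?v c d"
  proof (cases "c = a \<or> d = a")
    case True
    then show ?thesis
      using a[of c] a[of d] interlaced_sym[of ?u c d] interlaced_sym[of ?v c d] by metis
  next
    case False
    then have "c \<noteq> a" "d \<noteq> a"
      by simp_all
    then show ?thesis
      by (simp add: interlaced_def)
  qed
qed auto

lemma word_invariant_H1:
  assumes g: "gauss_word (x @ [a, a] @ y)"
  shows "word_invariant (x @ [a, a] @ y) = word_invariant (x @ y)" (is "word_invariant ?u = _")
proof -
  have "count_list x a = 0" "count_list y a = 0"
    using gauss_word_count[OF g, of a] by simp_all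
  then have new: "a \<notin> set (x @ y)"
    by (simp add: count_list_0_iff)
  have iso: "\<not> interlaced ?u a d" for d
    using interlaced_iff[OF g, of x a "[]" y d] interlaced_irrefl[OF g, of a]
    by (cases "d = a") auto
  then have iso': "\<not> interlaced ?u d a" for d
    by (simp only: interlaced_sym[of ?u d a] not_False_eq_True)
  have "set ?u = insert a (set (x @ y))"
    by auto
  then have "word_invariant ?u = graph_invariant (set (x @ y)) (interlaced ?u)"
    using graph_invariant_isolated[of "set (x @ y)" a "interlaced ?u", OF finite_set new iso iso']
    by (simp only: word_invariant_def)
  also have "\<dots> = word_invariant (x @ y)"
    unfolding word_invariant_def
    by (rule graph_invariant_cong) (use new in \<open>auto simp: interlaced_def\<close>)
  finally show ?thesis .
qed

lemma word_invariant_H2: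
  assumes g: "gauss_word (x @ [a, b] @ y @ [b, a] @ z)" and ab: "a \<noteq> b"
  shows "word_invariant (x @ [a, b] @ y @ [b, a] @ z) = word_invariant (x @ y @ z)"
    (is "word_invariant ?u = word_invariant ?v")
proof -
  have "count_list ?v a = 0" "count_list ?v b = 0"
    using gauss_word_count[OF g, of a] gauss_word_count[OF g, of b] ab by auto
  then have new: "a \<notin> set ?v" "b \<notin> set ?v"
    by (simp_all add: count_list_0_iff)
  have tw: "interlaced ?u a d = interlaced ?u b d" for d
  proof -
    have "interlaced ?u a d \<longleftrightarrow> count_list ([b] @ y @ [b]) d = 1" if "d \<noteq> a"
      using interlaced_iff[OF g, of x a "[b] @ y @ [b]" z d] that by simp
    moreover have "interlaced ?u b d \<longleftrightarrow> count_list y d = 1" if "d \<noteq> b"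
      using interlaced_iff[OF g, of "x @ [a]" b y "[a] @ z" d] that by simp
    moreover have "count_list y a = 0" "count_list y b = 0"
      using new by (simp_all add: count_list_0_iff)
    ultimately show ?thesis
      using ab interlaced_irrefl[OF g] by (cases "d = a"; cases "d = b") auto
  qed
  then have tw': "interlaced ?u d a = interlaced ?u d b" for d
    by (simp only: interlaced_sym[of ?u d])
  have "set ?u = insert a (insert b (set ?v))"
    by auto
  then have "word_invariant ?u = graph_invariant (set ?v) (interlaced ?u)"
    using graph_invariant_twins[of "set ?v" a b "interlaced ?u", OF finite_set new ab tw tw']
    by (simp only: word_invariant_def)
  also have "\<dots> = word_invariant ?v"
    unfolding word_invariant_def
    by (rule graph_invariant_cong) (use new in \<open>auto simp: interlaced_def\<close>)
  finally show ?thesis .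
qed

text \<open>
  Another letter \<open>d\<close> is interlaced with \<open>a\<close>, \<open>c\<close> or \<open>b\<close> when it occurs once in \<open>y\<close>, in \<open>z\<close>, or in \<open>y\<close> and
  \<open>z\<close> together, and this is true before and after the move. As these numbers add up,
  \<open>d\<close> is interlaced with an even number of the three letters.
\<close>

lemma word_invariant_H3:
  assumes g: "gauss_word (x @ [a, b] @ y @ [a, c] @ z @ [b, c] @ t)"
    "gauss_word (x @ [b, a] @ y @ [c, a] @ z @ [c, b] @ t)"
    and abc: "distinct [a, b, c]"
  shows "word_invariant (x @ [a, b] @ y @ [a, c] @ z @ [b, c] @ t)
       = word_invariant (x @ [b, a] @ y @ [c, a] @ z @ [c, b] @ t)"
    (is "word_invariant ?u = word_invariant ?v")
proof -
  let ?W = "set (x @ y @ z @ t)"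
  have ne: "a \<noteq> b" "a \<noteq> c" "b \<noteq> c"
    using abc by auto
  have "count_list (x @ y @ z @ t) a = 0" "count_list (x @ y @ z @ t) b = 0"
    "count_list (x @ y @ z @ t) c = 0"
    using gauss_word_count[OF g(1), of a] gauss_word_count[OF g(1), of b]
      gauss_word_count[OF g(1), of c] ne by auto
  then have new: "a \<notin> ?W" "b \<notin> ?W" "c \<notin> ?W"
    by (simp_all add: count_list_0_iff)
  then have zero: "count_list y a = 0" "count_list y b = 0" "count_list y c = 0"
    "count_list z a = 0" "count_list z b = 0" "count_list z c = 0"
    by (simp_all add: count_list_0_iff)
  have u: "d \<noteq> a \<Longrightarrow> interlaced ?u a d \<longleftrightarrow> count_list ([b] @ y) d = 1"
    "d \<noteq> b \<Longrightarrow> interlaced ?u b d \<longleftrightarrow> count_list (y @ [a, c] @ z) d = 1"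
    "d \<noteq> c \<Longrightarrow> interlaced ?u c d \<longleftrightarrow> count_list (z @ [b]) d = 1" for d
    using interlaced_iff[OF g(1), of x a "[b] @ y" "[c] @ z @ [b, c] @ t" d]
      interlaced_iff[OF g(1), of "x @ [a]" b "y @ [a, c] @ z" "[c] @ t" d]
      interlaced_iff[OF g(1), of "x @ [a, b] @ y @ [a]" c "z @ [b]" t d]
    by simp_all
  have v: "d \<noteq> a \<Longrightarrow> interlaced ?v a d \<longleftrightarrow> count_list (y @ [c]) d = 1"
    "d \<noteq> b \<Longrightarrow> interlaced ?v b d \<longleftrightarrow> count_list ([a] @ y @ [c, a] @ z @ [c]) d = 1"
    "d \<noteq> c \<Longrightarrow> interlaced ?v c d \<longleftrightarrow> count_list ([a] @ z) d = 1" for d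
    using interlaced_iff[OF g(2), of "x @ [b]" a "y @ [c]" "z @ [c, b] @ t" d]
      interlaced_iff[OF g(2), of x b "[a] @ y @ [c, a] @ z @ [c]" t d]
      interlaced_iff[OF g(2), of "x @ [b, a] @ y" c "[a] @ z" "[b] @ t" d]
    by simp_all
  have set: "set ?u = insert a (insert b (insert c ?W))" "set ?v = insert a (insert b (insert c ?W))"
    by auto
  have "graph_invariant (insert a (insert b (insert c ?W))) (interlaced ?v)
      = graph_invariant (insert a (insert b (insert c ?W))) (interlaced ?u)"
  proof (rule graph_invariant_triangle)
    show "interlaced ?u a b" "interlaced ?u b c" "\<not> interlaced ?u a c"
      "\<not> interlaced ?v a b" "\<not> interlaced ?v b c" "interlaced ?v a c"
      using ne zero u(1,2)[of b] u(1,2)[of c] v(1,2)[of b] v(1,2)[of c] by simp_all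
  next
    fix p q assume p: "p \<in> ?W" and q: "q \<in> insert a (insert b (insert c ?W))"
    have pn: "p \<noteq> a" "p \<noteq> b" "p \<noteq> c"
      using p new by blast+
    have "interlaced ?v r p = interlaced ?u r p" if "r \<in> {a, b, c}" for r
      using that pn u[of p] v[of p] by auto
    moreover have "interlaced ?v p q = interlaced ?u p q" if "q \<in> ?W"
    proof -
      have "q \<noteq> a" "q \<noteq> b" "q \<noteq> c"
        using that new by blast+
      then show ?thesis
        using pn by (simp add: interlaced_def)
    qed
    ultimately show "interlaced ?v p q = interlaced ?u p q"
      using q interlaced_sym[of ?u p q] interlaced_sym[of ?v p q] by blast
  next
    fix p assume p: "p \<in> ?W"
    then have pn: "p \<noteq> a" "p \<noteq> b" "p \<noteq> c"
      using new by blast+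
    have "count_list y p + count_list z p \<le> 2"
      using gauss_word_count[OF g(1), of p] pn by auto
    then have "(count_list y p + count_list z p = 1) = ((count_list y p = 1) \<noteq> (count_list z p = 1))"
      by linarith
    then have "interlaced ?u b p = (interlaced ?u a p \<noteq> interlaced ?u c p)"
      using pn u[of p] by simp
    then show "interlaced ?u p b = (interlaced ?u p a \<noteq> interlaced ?u p c)"
      by (simp only: interlaced_sym[of ?u p])
  qed (rule finite_set new ne interlaced_sym interlaced_irrefl[OF g(1)] interlaced_irrefl[OF g(2)])+
  then show ?thesis
    unfolding word_invariant_def set by (rule sym)
qed

lemma word_invariant_move:
  assumes "homotopy_move u v" "gauss_word u" "gauss_word v"
  shows "word_invariant u = word_invariant v"
  using assms
proof cases
  case (Shift a x y)
  show ?thesis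
    unfolding Shift by (rule word_invariant_shift) (use assms(2,3) Shift in simp_all)
next
  case (H1 x a y)
  show ?thesis
    unfolding H1 by (rule word_invariant_H1) (use assms(2) H1 in simp)
next
  case (H2 a b x y z)
  show ?thesis
    unfolding H2(1,2) by (rule word_invariant_H2) (use assms(2) H2 in simp_all)
next
  case (H3 a b c x y z t)
  show ?thesis
    unfolding H3(1,2) by (rule word_invariant_H3) (use assms(2,3) H3 in simp_all)
qed

lemma word_invariant_homotopic:
  assumes "homotopic u v"
  shows "word_invariant u = word_invariant v"
  using assms unfolding homotopic_def
proof (induction rule: rtranclp_induct)
  case (step v w)
  then have "word_invariant v = word_invariant w"
    unfolding homotopy_step_def
    by (auto dest: word_invariant_move word_invariant_isomorphic)
  then show ?case
    using step.IH by simp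
qed simp


section \<open>A homotopically nontrivial word\<close>

text \<open>
  In the interlacement graph of this word only \<open>3\<close> and \<open>4\<close> have odd degree. The vertex \<open>0\<close> is adjacent
  to \<open>4\<close> but not to \<open>3\<close>, with which it has the single common neighbour \<open>4\<close>, so \<open>0\<close> is special. The
  vertices \<open>1\<close> and \<open>2\<close> have two and no neighbours of odd degree, respectively, and \<open>5\<close> has the two
  common neighbours \<open>1\<close> and \<open>3\<close> with its only odd-degree non-neighbour \<open>4\<close>.
\<close>

definition witness :: "nat list" where
  "witness = [0, 1, 2, 3, 4, 5, 1, 3, 5, 0, 4, 2]"

lemma word_invariant_witness: "word_invariant witness"
proof -
  let ?V = "{0, 1, 2, 3, 4, 5} :: nat set" and ?L = "interlaced witness"
  have set: "set witness = ?V"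
    by (auto simp: witness_def)
  have "\<forall>y\<in>?V. ?L 0 y \<longleftrightarrow> y \<in> {2, 4}" "\<forall>y\<in>?V. ?L 1 y \<longleftrightarrow> y \<in> {2, 3, 4, 5}"
    "\<forall>y\<in>?V. ?L 2 y \<longleftrightarrow> y \<in> {0, 1}" "\<forall>y\<in>?V. ?L 3 y \<longleftrightarrow> y \<in> {1, 4, 5}"
    "\<forall>y\<in>?V. ?L 4 y \<longleftrightarrow> y \<in> {0, 1, 3}" "\<forall>y\<in>?V. ?L 5 y \<longleftrightarrow> y \<in> {1, 3}"
    by (simp_all add: interlaced_def witness_def)
  note L = this[simplified]
  have deg: "\<not> odd_degree ?V ?L 0" "\<not> odd_degree ?V ?L 1" "\<not> odd_degree ?V ?L 2"
    "odd_degree ?V ?L 3" "odd_degree ?V ?L 4" "\<not> odd_degree ?V ?L 5"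
    by (simp_all add: odd_degree_def L)
  have com: "odd_common ?V ?L 0 3" "\<not> odd_common ?V ?L 5 4"
    by (simp_all add: odd_common_def L)
  have "special ?V ?L 0" "\<not> special ?V ?L 1" "\<not> special ?V ?L 2" "\<not> special ?V ?L 3"
    "\<not> special ?V ?L 4" "\<not> special ?V ?L 5"
    unfolding special_def using deg com L by simp_all
  then show ?thesis
    unfolding word_invariant_def graph_invariant_def set by simp
qed

theorem corollary4p4:
  shows "\<exists>w :: 'a::infinite list. gauss_word w \<and> \<not> homotopically_trivial w"
proof -
  \<comment> \<open>An infinite letter type contains a copy of the naturals, and the invariant does not depend on
    the names of the letters.\<close>
  obtain e :: "nat \<Rightarrow> 'a" where e: "inj e"
    using infinite_countable_subset[OF infinite_UNIV] by blast
  have "gauss_isomorphic witness (map e witness)"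
    unfolding gauss_isomorphic_def
    using e by (intro exI[of _ e]) (auto simp: bij_betw_def inj_on_def)
  then have "word_invariant (map e witness)"
    using word_invariant_isomorphic word_invariant_witness by blast
  moreover have "\<not> word_invariant ([] :: 'a list)"
    by (simp add: word_invariant_def graph_invariant_def)
  ultimately have "\<not> homotopically_trivial (map e witness)"
    unfolding homotopically_trivial_def using word_invariant_homotopic by blast
  moreover have "gauss_word (map e witness)"
    using e by (simp add: gauss_word_def witness_def inj_eq)
  ultimately show ?thesis
    by blast
qed

end
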